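(* Let $t$ be a positive integer. There exists no Hadamard matrix of order $16t$ such that every quadruple of distinct rows has type $t$ or $2t$.
   Context: A Hadamard matrix of order $n$ is an $n\times n$ matrix $H=(h_{uv})$ with entries in $\{-1,1\}$ such that $HH^\top=nI$. For four distinct rows $i,j,k,\ell$ of $H$, put $P_{ijk\ell}=\left|\sum_{r=1}^n h_{ir}h_{jr}h_{kr}h_{\ell r}\right|$; the type of the quadruple $\{i,j,k,\ell\}$ is $T_{ijk\ell}=\frac{n-P_{ijk\ell}}{8}$. *)

theory Defs
  imports Complex_Main "Jordan_Normal_Form.Matrix"
begin

definition hadamard_matrix :: "nat \<Rightarrow> int mat \<Rightarrow> bool" where
  "hadamard_matrix n H \<longleftrightarrow>
     H \<in> carrier_mat n n \<and>
     elements_mat H \<subseteq> {-1, 1} \<and>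
     H * transpose_mat H = of_nat n \<cdot>\<^sub>m 1\<^sub>m n"

text \<open>Rows and columns are indexed from 0. The two definitions below are meant for four distinct
  row indices of a Hadamard matrix, whose order is then the number of its columns.\<close>

definition profile :: "int mat \<Rightarrow> nat \<Rightarrow> nat \<Rightarrow> nat \<Rightarrow> nat \<Rightarrow> int" where
  "profile H i j k l =
     \<bar>\<Sum>r<dim_col H. H $$ (i, r) * H $$ (j, r) * H $$ (k, r) * H $$ (l, r)\<bar>"

text \<open>The type is taken as a real number, so that the division by 8 is exact and no integrality
  is built into the definition.\<close>

definition quadruple_type :: "int mat \<Rightarrow> nat \<Rightarrow> nat \<Rightarrow> nat \<Rightarrow> nat \<Rightarrow> real" where
  "quadruple_type H i j k l = (real (dim_col H) - real_of_int (profile H i j k l)) / 8"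

end

theory Submission imports Defs "Jordan_Normal_Form.Determinant" begin

text \<open>A matrix of order \<open>n = 16 * t\<close> with these types has all quadruple sums equal to 0 or
  \<open>\<plusminus>n/2\<close>. Expand the entrywise product \<open>x\<close> of three rows in the orthogonal basis of
  rows. By Parseval exactly four coefficients are nonzero, so \<open>2 * x\<close> is a signed sum of four
  distinct rows. As \<open>x\<close> has entries \<open>\<plusminus>1\<close>, an odd number of the four signed
  entries is negative in every column, so the product of the four rows is constant. These rows
  then have type 0.\<close>

lemma hadamard_matrix_entry:
  assumes "hadamard_matrix n H" "i < n" "r < n"
  shows "H $$ (i, r) = 1 \<or> H $$ (i, r) = -1"
proof -
  have "H $$ (i, r) \<in> elements_mat H"
    using assms unfolding hadamard_matrix_def elements_mat_def by force
  then show ?thesis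
    using assms unfolding hadamard_matrix_def by auto
qed

lemma hadamard_matrix_rows_orthogonal:
  assumes "hadamard_matrix n H" "i < n" "j < n"
  shows "(\<Sum>r<n. H $$ (i, r) * H $$ (j, r)) = (if i = j then int n else 0)"
proof -
  have H: "H \<in> carrier_mat n n" and eq: "H * transpose_mat H = of_nat n \<cdot>\<^sub>m 1\<^sub>m n"
    using assms unfolding hadamard_matrix_def by auto
  have "(H * transpose_mat H) $$ (i, j) = (\<Sum>r<n. H $$ (i, r) * H $$ (j, r))"
    using H assms by (simp add: scalar_prod_def atLeast0LessThan)
  then show ?thesis
    using assms unfolding eq by (auto split: if_splits)
qed

text \<open>Over the reals, row orthogonality says that \<open>B\<close>, the transpose divided by
  \<open>n\<close>, is a right inverse of \<open>A\<close>. For square matrices a right inverse is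
  also a left inverse, and the entries of \<open>B * A\<close> are the column inner products divided
  by \<open>n\<close>. The passage to real matrices makes the division by \<open>n\<close>
  possible.\<close>

lemma hadamard_matrix_columns_orthogonal:
  assumes "hadamard_matrix n H" "r < n" "s < n"
  shows "(\<Sum>l<n. H $$ (l, r) * H $$ (l, s)) = (if r = s then int n else 0)"
proof -
  define A :: "real mat" where "A = map_mat of_int H"
  define B where "B = (1 / real n) \<cdot>\<^sub>m transpose_mat A"
  have n: "n > 0" using assms by simp
  have A: "A \<in> carrier_mat n n" and B: "B \<in> carrier_mat n n"
    using assms unfolding A_def B_def hadamard_matrix_def by auto
  have ent: "A $$ (i, j) = of_int (H $$ (i, j))" if "i < n" "j < n" for i j
    using that assms unfolding A_def hadamard_matrix_def by auto
  have "A * B = 1\<^sub>m n"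
  proof (rule eq_matI)
    fix i j assume "i < dim_row (1\<^sub>m n :: real mat)" "j < dim_col (1\<^sub>m n :: real mat)"
    then have ij: "i < n" "j < n" by auto
    have "(A * B) $$ (i, j) = (\<Sum>k<n. A $$ (i, k) * (A $$ (j, k) / real n))"
      using A B ij by (simp add: B_def scalar_prod_def atLeast0LessThan)
    also have "\<dots> = of_int (\<Sum>k<n. H $$ (i, k) * H $$ (j, k)) / real n"
      using ij by (simp add: ent sum_divide_distrib)
    finally show "(A * B) $$ (i, j) = 1\<^sub>m n $$ (i, j)"
      using hadamard_matrix_rows_orthogonal[OF assms(1) ij] ij n by simp
  qed (use A B in auto)
  then have "B * A = 1\<^sub>m n"
    using mat_mult_left_right_inverse[OF A B] by simp
  moreover have "(B * A) $$ (r, s) = (\<Sum>l<n. A $$ (l, r) / real n * A $$ (l, s))"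
    using A B assms by (simp add: B_def scalar_prod_def atLeast0LessThan)
  moreover have "\<dots> = of_int (\<Sum>l<n. H $$ (l, r) * H $$ (l, s)) / real n"
    using assms by (simp add: ent sum_divide_distrib)
  ultimately have "real_of_int (\<Sum>l<n. H $$ (l, r) * H $$ (l, s)) = (if r = s then real n else 0)"
    using assms n by (auto simp: field_simps split: if_splits)
  then show ?thesis
    by (auto split: if_splits simp del: of_int_sum)
qed

text \<open>The inner sum is the coefficient of \<open>x\<close> along row \<open>l\<close>, so this
  recovers \<open>x\<close> from its coefficients, up to the squared norm \<open>n\<close> of the
  rows. After exchanging the sums, column orthogonality leaves only the term
  \<open>s = r\<close>.\<close>

lemma hadamard_matrix_expansion:
  assumes "hadamard_matrix n H" "r < n"
  shows "(\<Sum>l<n. (\<Sum>s<n. x s * H $$ (l, s)) * H $$ (l, r)) = int n * x r"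
proof -
  have "(\<Sum>l<n. (\<Sum>s<n. x s * H $$ (l, s)) * H $$ (l, r))
      = (\<Sum>s<n. \<Sum>l<n. x s * H $$ (l, s) * H $$ (l, r))"
    unfolding sum_distrib_right by (rule sum.swap)
  also have "\<dots> = (\<Sum>s<n. x s * (if s = r then int n else 0))"
    using hadamard_matrix_columns_orthogonal[OF assms(1) _ assms(2)]
    by (intro sum.cong) (simp_all add: mult.assoc flip: sum_distrib_left)
  also have "\<dots> = int n * x r"
    using assms(2) by (simp add: if_distrib cong: if_cong)
  finally show ?thesis .
qed

text \<open>One factor of each square is written out as a sum over \<open>r\<close>; exchanging the
  sums then produces the expansion of \<open>x r\<close>.\<close>

lemma hadamard_matrix_parseval:
  assumes "hadamard_matrix n H"
  shows "(\<Sum>l<n. (\<Sum>s<n. x s * H $$ (l, s))\<^sup>2) = int n * (\<Sum>r<n. (x r)\<^sup>2)"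
proof -
  have "(\<Sum>l<n. (\<Sum>s<n. x s * H $$ (l, s))\<^sup>2)
      = (\<Sum>l<n. \<Sum>r<n. x r * ((\<Sum>s<n. x s * H $$ (l, s)) * H $$ (l, r)))"
    unfolding power2_eq_square
    by (intro sum.cong refl) (subst sum_distrib_left, simp add: mult_ac)
  also have "\<dots> = (\<Sum>r<n. x r * (\<Sum>l<n. (\<Sum>s<n. x s * H $$ (l, s)) * H $$ (l, r)))"
    unfolding sum_distrib_left by (rule sum.swap)
  also have "\<dots> = (\<Sum>r<n. int n * (x r)\<^sup>2)"
    using hadamard_matrix_expansion[OF assms]
    by (intro sum.cong) (simp_all add: power2_eq_square)
  finally show ?thesis by (simp add: sum_distrib_left)
qed

text \<open>The sum is 2 or -2, so exactly one or exactly three of the four signs are -1.\<close>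

lemma prod_of_four_signs:
  fixes a b c d x :: int
  assumes "a = 1 \<or> a = -1" "b = 1 \<or> b = -1" "c = 1 \<or> c = -1" "d = 1 \<or> d = -1"
    and "x = 1 \<or> x = -1" and "a + b + c + d = 2 * x"
  shows "a * b * c * d = -1"
  using assms by auto

lemma card_eq_4E:
  assumes "card S = 4"
  obtains a b c d where "S = {a, b, c, d}" "distinct [a, b, c, d]"
proof -
  have "finite S" using assms by (simp add: card_ge_0_finite)
  then obtain xs where xs: "set xs = S" "distinct xs"
    using finite_distinct_list by blast
  then have "length xs = Suc (Suc (Suc (Suc 0)))"
    using assms distinct_card[of xs] by simp
  then obtain a b c d where "xs = [a, b, c, d]"
    by (auto simp: length_Suc_conv)
  with xs that show thesis by auto
qed

theorem theorem3p2:
  fixes t :: nat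
  assumes "t > 0"
  shows "\<not> (\<exists>H. hadamard_matrix (16 * t) H \<and>
    (\<forall>i < 16 * t. \<forall>j < 16 * t. \<forall>k < 16 * t. \<forall>l < 16 * t. distinct [i, j, k, l] \<longrightarrow>
       quadruple_type H i j k l = real t \<or> quadruple_type H i j k l = real (2 * t)))"
proof
  define n where "n = 16 * t"
  assume "\<exists>H. hadamard_matrix (16 * t) H \<and>
    (\<forall>i < 16 * t. \<forall>j < 16 * t. \<forall>k < 16 * t. \<forall>l < 16 * t. distinct [i, j, k, l] \<longrightarrow>
       quadruple_type H i j k l = real t \<or> quadruple_type H i j k l = real (2 * t))"
  then obtain H where H: "hadamard_matrix n H"
    and ty: "\<And>i j k l. \<lbrakk>i < n; j < n; k < n; l < n; distinct [i, j, k, l]\<rbrakk> \<Longrightarrow>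
       quadruple_type H i j k l = real t \<or> quadruple_type H i j k l = real (2 * t)"
    unfolding n_def by blast
  have dim: "dim_col H = n" using H unfolding hadamard_matrix_def by auto
  have ent: "H $$ (i, r) = 1 \<or> H $$ (i, r) = -1" if "i < n" "r < n" for i r
    using hadamard_matrix_entry[OF H that] .
  \<comment> \<open>Solving (16t - P)/8 = t gives P = 8t, and (16t - P)/8 = 2t gives P = 0.\<close>
  have profile: "profile H i j k l = 8 * int t \<or> profile H i j k l = 0"
    if "i < n" "j < n" "k < n" "l < n" "distinct [i, j, k, l]" for i j k l
    using ty[OF that] unfolding quadruple_type_def dim n_def by auto
  have lt: "0 < n" "1 < n" "2 < n" using assms by (auto simp: n_def)
  define x where "x r = H $$ (0, r) * H $$ (1, r) * H $$ (2, r)" for r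
  define c where "c l = (\<Sum>r<n. x r * H $$ (l, r))" for l
  have x: "x r = 1 \<or> x r = -1" if "r < n" for r
    using ent[OF lt(1) that] ent[OF lt(2) that] ent[OF lt(3) that] unfolding x_def by auto
  have c: "c l = 0 \<or> \<bar>c l\<bar> = 8 * int t" if l: "l < n" for l
  proof (cases "l \<in> {0, 1, 2}")
    case True
    then consider "l = 0" | "l = 1" | "l = 2" by blast
    \<comment> \<open>Here \<open>i\<close> and \<open>j\<close> are the two elements of {0, 1, 2}
      other than \<open>l\<close>. Row \<open>l\<close> occurs twice in the product and cancels, so
      \<open>c l\<close> is the inner product of two distinct rows, which is 0.\<close>
    then have "\<exists>i j. i < n \<and> j < n \<and> i \<noteq> j \<and>
        (\<forall>r. x r * H $$ (l, r) = H $$ (l, r) * H $$ (l, r) * (H $$ (i, r) * H $$ (j, r)))"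
    proof cases
      case 1
      show ?thesis by (rule exI[of _ 1], rule exI[of _ 2]) (use 1 lt in \<open>auto simp: x_def\<close>)
    next
      case 2
      show ?thesis by (rule exI[of _ 0], rule exI[of _ 2]) (use 2 lt in \<open>auto simp: x_def\<close>)
    next
      case 3
      show ?thesis by (rule exI[of _ 0], rule exI[of _ 1]) (use 3 lt in \<open>auto simp: x_def\<close>)
    qed
    then obtain i j where ij: "i < n" "j < n" "i \<noteq> j"
      and xl: "\<And>r. x r * H $$ (l, r) = H $$ (l, r) * H $$ (l, r) * (H $$ (i, r) * H $$ (j, r))"
      by blast
    have "H $$ (l, r) * H $$ (l, r) = 1" if "r < n" for r
      using ent[OF l that] by auto
    then have "c l = (\<Sum>r<n. H $$ (i, r) * H $$ (j, r))"
      unfolding c_def xl by simp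
    then show ?thesis
      using hadamard_matrix_rows_orthogonal[OF H ij(1,2)] ij(3) by simp
  next
    case False
    \<comment> \<open>Now the four rows are distinct, and \<open>c l\<close> is the sum whose
      absolute value is their profile.\<close>
    then have "profile H 0 1 2 l = 8 * int t \<or> profile H 0 1 2 l = 0"
      using lt l by (intro profile) auto
    then show ?thesis unfolding profile_def dim c_def x_def by auto
  qed
  define S where "S = {l. l < n \<and> c l \<noteq> 0}"
  have S: "finite S" "S \<subseteq> {..<n}" unfolding S_def by auto
  have c_S: "c l = sgn (c l) * (8 * int t)" if "l \<in> S" for l
    using c[of l] that unfolding S_def by (auto simp: sgn_if)
  \<comment> \<open>Parseval counts the nonzero coefficients: n^2 = |S| (8t)^2 = |S| (n/2)^2, so |S|
    = 4.\<close>
  have "int n * int n = int n * (\<Sum>r<n. (x r)\<^sup>2)"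
  proof -
    have "(x r)\<^sup>2 = 1" if "r < n" for r using x[OF that] by auto
    then show ?thesis by simp
  qed
  also have "\<dots> = (\<Sum>l<n. (c l)\<^sup>2)"
    unfolding c_def by (rule hadamard_matrix_parseval[OF H, symmetric])
  also have "\<dots> = (\<Sum>l\<in>S. (c l)\<^sup>2)"
    by (rule sum.mono_neutral_right) (auto simp: S_def)
  also have "\<dots> = (\<Sum>l\<in>S. (8 * int t)\<^sup>2)"
  proof (rule sum.cong)
    fix l assume "l \<in> S"
    then show "(c l)\<^sup>2 = (8 * int t)\<^sup>2"
      using c[of l] by (metis (mono_tags, lifting) S_def mem_Collect_eq power2_abs)
  qed simp
  finally have "card S = 4"
    using assms unfolding n_def by (simp add: power2_eq_square)
  then obtain p q u v where Seq: "S = {p, q, u, v}" and dist: "distinct [p, q, u, v]"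
    by (rule card_eq_4E)
  define e where "e l = sgn (c l)" for l
  have e: "e l = 1 \<or> e l = -1" if "l \<in> S" for l
    using that unfolding e_def S_def by (auto simp: sgn_if)
  have prod: "H $$ (p, r) * H $$ (q, r) * H $$ (u, r) * H $$ (v, r) = - (e p * e q * e u * e v)"
    if r: "r < n" for r
  proof -
    \<comment> \<open>Each coefficient on \<open>S\<close> is \<open>e l\<close> times 8t, which is
      n/2. Cancelling 8t in the expansion of n times \<open>x r\<close> leaves 2 times
      \<open>x r\<close>.\<close>
    have "8 * int t * (\<Sum>l\<in>S. e l * H $$ (l, r)) = (\<Sum>l\<in>S. c l * H $$ (l, r))"
      unfolding sum_distrib_left
    proof (rule sum.cong)
      fix l assume "l \<in> S"
      from c_S[OF this] show "8 * int t * (e l * H $$ (l, r)) = c l * H $$ (l, r)"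
        unfolding e_def by (simp add: algebra_simps)
    qed simp
    also have "\<dots> = (\<Sum>l<n. c l * H $$ (l, r))"
      by (rule sum.mono_neutral_left) (auto simp: S_def)
    also have "\<dots> = 8 * int t * (2 * x r)"
      using hadamard_matrix_expansion[OF H r, of x] unfolding c_def n_def by simp
    finally have "(\<Sum>l\<in>S. e l * H $$ (l, r)) = 2 * x r"
      using assms by simp
    then have sum: "e p * H $$ (p, r) + e q * H $$ (q, r) + e u * H $$ (u, r) + e v * H $$ (v, r) = 2 * x r"
      unfolding Seq using dist by (simp add: add.assoc)
    have sgn: "e l * H $$ (l, r) = 1 \<or> e l * H $$ (l, r) = -1" if "l \<in> S" for l
      using e[OF that] ent[of l r] r S that by auto
    \<comment> \<open>The signs \<open>e\<close> can afterwards be moved to the other side, since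
      each is its own inverse; what stands there does not depend on the column
      \<open>r\<close>.\<close>
    have "e p * H $$ (p, r) * (e q * H $$ (q, r)) * (e u * H $$ (u, r)) * (e v * H $$ (v, r)) = -1"
      by (rule prod_of_four_signs[OF _ _ _ _ x[OF r] sum]; rule sgn) (auto simp: Seq)
    then show ?thesis
      using e[of p] e[of q] e[of u] e[of v] unfolding Seq by auto
  qed
  \<comment> \<open>All \<open>n\<close> summands are the same sign, so nothing cancels and the
    profile has the maximal value 16t, which differs from both 8t and 0 because t > 0.\<close>
  have "profile H p q u v = \<bar>\<Sum>r<n. - (e p * e q * e u * e v)\<bar>"
    unfolding profile_def dim using prod by simp
  also have "\<dots> = int n"
    using e[of p] e[of q] e[of u] e[of v] unfolding Seq by (auto simp: abs_mult)
  finally have "profile H p q u v = 16 * int t"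
    by (simp add: n_def)
  moreover have "profile H p q u v = 8 * int t \<or> profile H p q u v = 0"
    by (rule profile) (use S dist in \<open>auto simp: Seq\<close>)
  ultimately show False using assms by simp
qed

end
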